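(* Let $A,B$ be finite alphabets, let $\sigma\colon A^*\to B^*$ be a morphism and let $x\in A^{\mathbb Z}$ be such that $\sigma(x)$ is two-sided infinite. 1. If $\sigma$ is one-sided recognizable in the sense of Mossé for $x$, then it is recognizable in the sense of Mossé for $x$. 2. If $\sigma(A)$ is a suffix code and if $\sigma$ is recognizable in the sense of Mossé for $x$, then it is one-sided recognizable in the sense of Mossé for $x$.
   Context: For a two-sided sequence $x$ and $i\le j$, $x_{[i,j]}=x_ix_{i+1}\cdots x_j$ and $x_{[i,j)}=x_i\cdots x_{j-1}$. A morphism extends to $x\in A^{\mathbb Z}$ by $\sigma(x)=\cdots\sigma(x_{-1})\cdot\sigma(x_0)\sigma(x_1)\cdots$, with index $0$ at the beginning of $\sigma(x_0)\sigma(x_1)\cdots$. Let $x\in A^{\mathbb Z}$ be such that $y=\sigma(x)$ is two-sided infinite. The set of cutting points of $x$ is $$C(x)=\{|\sigma(x_{[0,n)})|\mid n\ge0\}\cup\{-|\sigma(x_{[n,0)})|\mid n<0\}.$$ $\sigma$ is recognizable in the sense of Mossé for $x$ if there is an $N\ge1$ (the scope) such that for all $i,j\in\mathbb Z$, whenever $y_{[i-N,i+N]}=y_{[j-N,j+N]}$, then $i\in C(x)\Leftrightarrow j\in C(x)$. $\sigma$ is one-sided recognizable in the sense of Mossé for $x\in A^{\mathbb Z}$ if there is an $N\ge1$ such that for all $i,j\in\mathbb Z$, whenever $y_{[i,i+N)}=y_{[j,j+N)}$, then $i\in C(x)\Leftrightarrow j\in C(x)$. A set $U$ of words is a suffix code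 if no element of $U$ is a suffix of another one; in particular the words in $U$ are nonempty. Here $\sigma(A)=\{\sigma(a)\mid a\in A\}$. *)

theory Defs
  imports Main "HOL-Library.Sublist"
begin

definition is_morphism :: "('a list \<Rightarrow> 'b list) \<Rightarrow> bool" where
  "is_morphism \<sigma> \<longleftrightarrow> \<sigma> [] = [] \<and> (\<forall>u v. \<sigma> (u @ v) = \<sigma> u @ \<sigma> v)"

definition factor_cc :: "(int \<Rightarrow> 'a) \<Rightarrow> int \<Rightarrow> int \<Rightarrow> 'a list" where
  "factor_cc x i j = map x [i..j]"

definition factor_co :: "(int \<Rightarrow> 'a) \<Rightarrow> int \<Rightarrow> int \<Rightarrow> 'a list" where
  "factor_co x i j = map x [i..j - 1]"

definition two_sided_infinite_image :: "('a list \<Rightarrow> 'b list) \<Rightarrow> (int \<Rightarrow> 'a) \<Rightarrow> bool" where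
  "two_sided_infinite_image \<sigma> x \<longleftrightarrow>
     (\<forall>m. \<exists>n\<ge>0. m < length (\<sigma> (factor_co x 0 n))) \<and>
     (\<forall>m. \<exists>n<0. m < length (\<sigma> (factor_co x n 0)))"

text \<open>
  The two-sided sequence \<open>\<sigma>(x)\<close>. A nonnegative index \<open>k\<close> is read off from a prefix
  \<open>\<sigma>(x\<^sub>0 \<dots> x\<^sub>n\<^sub>-\<^sub>1)\<close> of the right half that is long enough, and a negative one from a long
  enough suffix \<open>\<sigma>(x\<^sub>-\<^sub>n \<dots> x\<^sub>-\<^sub>1)\<close> of the left half, counting from its end. The values are
  meaningful only under \<^const>\<open>two_sided_infinite_image\<close>; see the lemmas
  \<open>morphism_image_right\<close> and \<open>morphism_image_left\<close>.
\<close>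

definition morphism_image :: "('a list \<Rightarrow> 'b list) \<Rightarrow> (int \<Rightarrow> 'a) \<Rightarrow> int \<Rightarrow> 'b" where
  "morphism_image \<sigma> x k =
     (if 0 \<le> k then
        let n = (LEAST n::nat. nat k < length (\<sigma> (factor_co x 0 (int n))))
        in \<sigma> (factor_co x 0 (int n)) ! nat k
      else
        let n = (LEAST n::nat. nat (- k) \<le> length (\<sigma> (factor_co x (- int n) 0)));
            w = \<sigma> (factor_co x (- int n) 0)
        in w ! (length w - nat (- k)))"

definition cutting_points :: "('a list \<Rightarrow> 'b list) \<Rightarrow> (int \<Rightarrow> 'a) \<Rightarrow> int set" where
  "cutting_points \<sigma> x =
     {int (length (\<sigma> (factor_co x 0 n))) | n. n \<ge> 0} \<union>
     {- int (length (\<sigma> (factor_co x n 0))) | n. n < 0}"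

definition mosse_recognizable :: "('a list \<Rightarrow> 'b list) \<Rightarrow> (int \<Rightarrow> 'a) \<Rightarrow> bool" where
  "mosse_recognizable \<sigma> x \<longleftrightarrow>
     (let y = morphism_image \<sigma> x in
      \<exists>N\<ge>1. \<forall>i j. factor_cc y (i - N) (i + N) = factor_cc y (j - N) (j + N) \<longrightarrow>
        (i \<in> cutting_points \<sigma> x \<longleftrightarrow> j \<in> cutting_points \<sigma> x))"

definition one_sided_mosse_recognizable :: "('a list \<Rightarrow> 'b list) \<Rightarrow> (int \<Rightarrow> 'a) \<Rightarrow> bool" where
  "one_sided_mosse_recognizable \<sigma> x \<longleftrightarrow>
     (let y = morphism_image \<sigma> x in
      \<exists>N\<ge>1. \<forall>i j. factor_co y i (i + N) = factor_co y j (j + N) \<longrightarrow>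
        (i \<in> cutting_points \<sigma> x \<longleftrightarrow> j \<in> cutting_points \<sigma> x))"

text \<open>
  Nonemptiness of the words is required explicitly, because the suffix condition alone
  would admit the set consisting of the empty word.
\<close>

definition suffix_code :: "'b list set \<Rightarrow> bool" where
  "suffix_code U \<longleftrightarrow> [] \<notin> U \<and> (\<forall>u\<in>U. \<forall>v\<in>U. suffix u v \<longrightarrow> u = v)"

lemma factor_co_append:
  assumes "i \<le> j" "j \<le> k"
  shows "factor_co x i k = factor_co x i j @ factor_co x j k"
proof -
  have "[i..k - 1] = [i..j - 1] @ [j..k - 1]"
    using assms upto_split1[of i j "k - 1"] by (cases "j = k") auto
  then show ?thesis by (simp add: factor_co_def)
qed

lemma morphism_image_right:
  fixes \<sigma> :: "'a list \<Rightarrow> 'b list" and x :: "int \<Rightarrow> 'a"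
  assumes m: "is_morphism \<sigma>" and n: "n \<ge> 0"
  defines "w \<equiv> \<sigma> (factor_co x 0 n)"
  shows "factor_co (morphism_image \<sigma> x) 0 (int (length w)) = w"
proof (rule nth_equalityI)
  show "length (factor_co (morphism_image \<sigma> x) 0 (int (length w))) = length w"
    by (simp add: factor_co_def)
next
  fix i assume "i < length (factor_co (morphism_image \<sigma> x) 0 (int (length w)))"
  then have i: "i < length w" by (simp add: factor_co_def)
  let ?P = "\<lambda>n::nat. i < length (\<sigma> (factor_co x 0 (int n)))"
  have P: "?P (nat n)" using i n by (simp add: w_def)
  define l where "l = (LEAST n. ?P n)"
  have l: "?P l" "l \<le> nat n" unfolding l_def by (rule LeastI, rule P) (rule Least_le, rule P)
  have "w = \<sigma> (factor_co x 0 (int l)) @ \<sigma> (factor_co x (int l) n)"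
    using m n l factor_co_append[of 0 "int l" n x] by (simp add: w_def is_morphism_def)
  then have "w ! i = \<sigma> (factor_co x 0 (int l)) ! i" using l by (simp add: nth_append)
  then show "factor_co (morphism_image \<sigma> x) 0 (int (length w)) ! i = w ! i"
    using i by (simp add: factor_co_def[of "morphism_image \<sigma> x"] morphism_image_def l_def)
qed

lemma morphism_image_left:
  fixes \<sigma> :: "'a list \<Rightarrow> 'b list" and x :: "int \<Rightarrow> 'a"
  assumes m: "is_morphism \<sigma>" and n: "n \<le> 0"
  defines "w \<equiv> \<sigma> (factor_co x n 0)"
  shows "factor_co (morphism_image \<sigma> x) (- int (length w)) 0 = w"
proof (rule nth_equalityI)
  show "length (factor_co (morphism_image \<sigma> x) (- int (length w)) 0) = length w"
    by (simp add: factor_co_def)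
next
  fix i assume "i < length (factor_co (morphism_image \<sigma> x) (- int (length w)) 0)"
  then have i: "i < length w" by (simp add: factor_co_def)
  define k where "k = length w - i"
  have k: "0 < k" "k \<le> length w" "i = length w - k" using i by (auto simp: k_def)
  let ?P = "\<lambda>n::nat. k \<le> length (\<sigma> (factor_co x (- int n) 0))"
  have P: "?P (nat (- n))" using k n by (simp add: w_def)
  define l where "l = (LEAST n. ?P n)"
  have l: "?P l" "l \<le> nat (- n)" unfolding l_def by (rule LeastI, rule P) (rule Least_le, rule P)
  define v where "v = \<sigma> (factor_co x (- int l) 0)"
  have w: "w = \<sigma> (factor_co x n (- int l)) @ v"
    using m n l factor_co_append[of n "- int l" 0 x] by (simp add: w_def v_def is_morphism_def)
  have "i = length (\<sigma> (factor_co x n (- int l))) + (length v - k)"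
    using l(1) k(3) w by (simp add: v_def)
  then have "w ! i = v ! (length v - k)" by (simp only: w nth_append_length_plus)
  moreover have "factor_co (morphism_image \<sigma> x) (- int (length w)) 0 ! i
      = morphism_image \<sigma> x (- int k)"
    using i k by (simp add: factor_co_def of_nat_diff)
  moreover have "morphism_image \<sigma> x (- int k) = v ! (length v - k)"
    using k by (simp add: morphism_image_def l_def v_def Let_def)
  ultimately show "factor_co (morphism_image \<sigma> x) (- int (length w)) 0 ! i = w ! i" by simp
qed

end

theory Submission
  imports Defs
begin

text \<open>
  Two-sided scopes only see more, which gives the first claim. For the second, let \<open>L\<close> bound
  the lengths of the \<open>\<sigma>(a)\<close>. From a cutting point \<open>i\<close> move \<open>N\<close> blocks to the right: this advances
  by some \<open>k\<close> with \<open>N \<le> k \<le> N L\<close>. If the windows of length \<open>N L + N + 1\<close> at \<open>i\<close> and \<open>j\<close> agree,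
  then two-sided recognizability makes \<open>j + k\<close> a cutting point. Reading the common word of length
  \<open>k\<close> from right to left, the suffix code property forces the blocks before \<open>i + k\<close> and \<open>j + k\<close>
  to coincide one by one, until \<open>i\<close> and \<open>j\<close> are reached.
\<close>

lemma factor_cc_conv_co: "factor_cc y i j = factor_co y i (j + 1)"
  by (simp add: factor_cc_def factor_co_def)

lemma length_factor_co [simp]: "length (factor_co y i j) = nat (j - i)"
  by (simp add: factor_co_def)

lemma factor_co_single: "factor_co y i (i + 1) = [y i]"
  by (simp add: factor_co_def)

lemma factor_co_eq_iff:
  "factor_co y i (i + l) = factor_co z j (j + l) \<longleftrightarrow> (\<forall>t. 0 \<le> t \<and> t < l \<longrightarrow> y (i + t) = z (j + t))"
  (is "?L \<longleftrightarrow> ?R")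
proof
  assume eq: ?L
  show ?R
  proof (intro allI impI)
    fix t assume "0 \<le> t \<and> t < l"
    then show "y (i + t) = z (j + t)"
      using arg_cong[OF eq, of "\<lambda>w. w ! nat t"] by (simp add: factor_co_def)
  qed
next
  assume ?R
  then show ?L by (auto intro!: nth_equalityI simp: factor_co_def)
qed

lemma factor_cc_window_eq_iff:
  "factor_cc y (i - N) (i + N) = factor_cc z (j - N) (j + N) \<longleftrightarrow>
    (\<forall>t. - N \<le> t \<and> t \<le> N \<longrightarrow> y (i + t) = z (j + t))"
  (is "?L \<longleftrightarrow> ?R")
proof -
  have "?L \<longleftrightarrow> factor_co y (i - N) ((i - N) + (2 * N + 1))
      = factor_co z (j - N) ((j - N) + (2 * N + 1))"
    by (simp add: factor_cc_conv_co algebra_simps)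
  also have "\<dots> \<longleftrightarrow> (\<forall>s. 0 \<le> s \<and> s < 2 * N + 1 \<longrightarrow> y (i - N + s) = z (j - N + s))"
    by (rule factor_co_eq_iff)
  also have "\<dots> \<longleftrightarrow> ?R"
  proof (intro iffI allI impI)
    fix t assume "\<forall>s. 0 \<le> s \<and> s < 2 * N + 1 \<longrightarrow> y (i - N + s) = z (j - N + s)" "- N \<le> t \<and> t \<le> N"
    then show "y (i + t) = z (j + t)"
      by (auto dest: spec[of _ "t + N"])
  next
    fix s assume ?R "0 \<le> s \<and> s < 2 * N + 1"
    then show "y (i - N + s) = z (j - N + s)"
      by (auto dest: spec[of _ "s - N"] simp: algebra_simps)
  qed
  finally show ?thesis .
qed

lemma suffix_factor_co: "i \<le> j \<Longrightarrow> j \<le> k \<Longrightarrow> suffix (factor_co y j k) (factor_co y i k)"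
  using factor_co_append[of i j k y] by (auto simp: suffix_def)

text \<open>Two suffixes of one word are comparable, the shorter being a suffix of the longer; in a
  suffix code this forces equality.\<close>

lemma suffix_code_eqI:
  assumes "suffix_code U" "u \<in> U" "v \<in> U" "suffix u w" "suffix v w"
  shows "u = v"
  using assms suffix_same_cases[of u w v] unfolding suffix_code_def by metis

lemma is_morphism_append: "is_morphism \<sigma> \<Longrightarrow> \<sigma> (u @ v) = \<sigma> u @ \<sigma> v"
  by (simp add: is_morphism_def)

lemma is_morphism_factor_co_snoc:
  assumes "is_morphism \<sigma>" "i \<le> n"
  shows "\<sigma> (factor_co x i (n + 1)) = \<sigma> (factor_co x i n) @ \<sigma> [x n]"
  using assms factor_co_append[of i n "n + 1" x]
  by (simp add: factor_co_single is_morphism_append)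

lemma is_morphism_factor_co_Cons:
  assumes "is_morphism \<sigma>" "n < j"
  shows "\<sigma> (factor_co x n j) = \<sigma> [x n] @ \<sigma> (factor_co x (n + 1) j)"
proof -
  have "factor_co x n j = [x n] @ factor_co x (n + 1) j"
    using assms(2) factor_co_append[of n "n + 1" j x] by (simp add: factor_co_single)
  then show ?thesis
    by (simp only: is_morphism_append[OF assms(1)])
qed

text \<open>Signed position in \<open>morphism_image \<sigma> x\<close> at which the block of
  \<open>x n\<close> begins. One map on all integers replaces the two families in
  \<open>cutting_points\<close>, so moving by blocks across the origin needs no case split
  later.\<close>

definition cut :: "('a list \<Rightarrow> 'b list) \<Rightarrow> (int \<Rightarrow> 'a) \<Rightarrow> int \<Rightarrow> int" where
  "cut \<sigma> x n = (if 0 \<le> n then int (length (\<sigma> (factor_co x 0 n)))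
                else - int (length (\<sigma> (factor_co x n 0))))"

lemma cutting_points_eq_range_cut: "cutting_points \<sigma> x = range (cut \<sigma> x)"
proof -
  have "cutting_points \<sigma> x = cut \<sigma> x ` {0..} \<union> cut \<sigma> x ` {..<0}"
    by (force simp: cutting_points_def cut_def)
  also have "\<dots> = range (cut \<sigma> x)"
    by (auto simp flip: image_Un intro!: arg_cong[where f = "image (cut \<sigma> x)"])
  finally show ?thesis .
qed

lemma cut_add_one:
  assumes "is_morphism \<sigma>"
  shows "cut \<sigma> x (n + 1) = cut \<sigma> x n + int (length (\<sigma> [x n]))"
proof (cases "0 \<le> n")
  case True
  then have "\<sigma> (factor_co x 0 (n + 1)) = \<sigma> (factor_co x 0 n) @ \<sigma> [x n]"
    by (rule is_morphism_factor_co_snoc[OF assms])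
  then show ?thesis using True by (simp add: cut_def)
next
  case False
  then have "\<sigma> (factor_co x n 0) = \<sigma> [x n] @ \<sigma> (factor_co x (n + 1) 0)"
    by (intro is_morphism_factor_co_Cons assms) simp
  moreover have "\<sigma> (factor_co x 0 0) = []"
    using assms by (simp add: factor_co_def is_morphism_def)
  \<comment> \<open>At \<open>n = -1\<close> the two branches of \<open>cut\<close> meet; both give
    0 at the origin because \<open>\<sigma> [] = []\<close>.\<close>
  ultimately show ?thesis using False by (cases "n = -1") (simp_all add: cut_def)
qed

lemma cut_mono:
  assumes m: "is_morphism \<sigma>" and "n \<le> k"
  shows "cut \<sigma> x n \<le> cut \<sigma> x k"
  using assms(2)
proof (induction rule: int_ge_induct)
  case (step k)
  then show ?case by (simp add: cut_add_one[OF m])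
qed simp

text \<open>The stretch between the origin and a cut is the image of the corresponding factor of
  \<open>x\<close>. Comparing the stretches for \<open>n\<close> and \<open>n + 1\<close> and
  cancelling the common part leaves one block.\<close>

lemma factor_co_morphism_image_cut:
  assumes m: "is_morphism \<sigma>"
  shows "factor_co (morphism_image \<sigma> x) (cut \<sigma> x n) (cut \<sigma> x (n + 1)) = \<sigma> [x n]"
proof (cases "0 \<le> n")
  case True
  let ?y = "morphism_image \<sigma> x"
  have "\<sigma> (factor_co x 0 (n + 1)) = \<sigma> (factor_co x 0 n) @ \<sigma> [x n]"
    using True by (rule is_morphism_factor_co_snoc[OF m])
  moreover have "factor_co ?y 0 (cut \<sigma> x (n + 1))
      = factor_co ?y 0 (cut \<sigma> x n) @ factor_co ?y (cut \<sigma> x n) (cut \<sigma> x (n + 1))"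
    using True by (intro factor_co_append) (simp_all add: cut_add_one[OF m], simp add: cut_def)
  moreover have "factor_co ?y 0 (cut \<sigma> x k) = \<sigma> (factor_co x 0 k)" if "0 \<le> k" for k
    using morphism_image_right[OF m that, of x] that by (simp add: cut_def)
  ultimately show ?thesis using True by simp
next
  case False
  let ?y = "morphism_image \<sigma> x"
  have "\<sigma> (factor_co x n 0) = \<sigma> [x n] @ \<sigma> (factor_co x (n + 1) 0)"
    using False by (intro is_morphism_factor_co_Cons m) simp
  moreover have "\<sigma> [] = []"
    using m by (simp add: is_morphism_def)
  then have left: "cut \<sigma> x k \<le> 0" "factor_co ?y (cut \<sigma> x k) 0 = \<sigma> (factor_co x k 0)" if "k \<le> 0" for k
    using morphism_image_left[OF m that, of x] that
    by (cases "k = 0"; simp add: cut_def; simp add: factor_co_def)+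
  moreover have "factor_co ?y (cut \<sigma> x n) 0
      = factor_co ?y (cut \<sigma> x n) (cut \<sigma> x (n + 1)) @ factor_co ?y (cut \<sigma> x (n + 1)) 0"
    using False left(1)[of "n + 1"] by (intro factor_co_append) (simp_all add: cut_add_one[OF m])
  ultimately show ?thesis using False by simp
qed

lemma suffix_block_factor_co:
  assumes "is_morphism \<sigma>" "i \<le> cut \<sigma> x n"
  shows "suffix (\<sigma> [x n]) (factor_co (morphism_image \<sigma> x) i (cut \<sigma> x (n + 1)))"
  using suffix_factor_co[OF assms(2) cut_mono[OF assms(1)], of "n + 1" "morphism_image \<sigma> x"]
  by (simp add: factor_co_morphism_image_cut[OF assms(1)])

text \<open>Each block has length between 1 and \<open>L\<close>, so a number of blocks translates
  into a distance with bounds independent of the position.\<close>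

lemma cut_add_bounds:
  assumes m: "is_morphism \<sigma>" and ne: "\<And>a. \<sigma> [a] \<noteq> []" and L: "\<And>a. length (\<sigma> [a]) \<le> L"
  shows "cut \<sigma> x n + int d \<le> cut \<sigma> x (n + int d)"
    and "cut \<sigma> x (n + int d) \<le> cut \<sigma> x n + int d * int L"
proof (induction d)
  case (Suc d)
  have step: "cut \<sigma> x (n + int (Suc d)) = cut \<sigma> x (n + int d) + int (length (\<sigma> [x (n + int d)]))"
    using cut_add_one[OF m, of x "n + int d"] by (simp add: ac_simps)
  have len: "1 \<le> int (length (\<sigma> [x (n + int d)]))"
    using ne[of "x (n + int d)"] by (cases "\<sigma> [x (n + int d)]") auto
  {
    case 1
    show ?case using Suc step len by simp
  next
    case 2
    show ?case using Suc step L[of "x (n + int d)"] by (simp add: algebra_simps)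
  }
qed simp_all

text \<open>Induction on \<open>d\<close>, removing the last block on both sides; \<open>p\<close>
  varies while \<open>n\<close> and \<open>j\<close> stay fixed. In the base case both words are
  empty, and the distance hypothesis alone gives \<open>j = cut \<sigma> x p\<close>.\<close>

lemma suffix_code_synchronize_left:
  assumes m: "is_morphism \<sigma>" and code: "suffix_code (range (\<lambda>a. \<sigma> [a]))"
    and eq: "factor_co (morphism_image \<sigma> x) (cut \<sigma> x n) (cut \<sigma> x (n + int d))
      = factor_co (morphism_image \<sigma> x) j (cut \<sigma> x p)"
    and j: "cut \<sigma> x p - j = cut \<sigma> x (n + int d) - cut \<sigma> x n"
  shows "j = cut \<sigma> x (p - int d)"
  using eq j
proof (induction d arbitrary: p)
  case (Suc d)
  let ?y = "morphism_image \<sigma> x" and ?c = "cut \<sigma> x"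
  define q r where "q = n + int d" and "r = p - 1"
  have qr: "n + int (Suc d) = q + 1" "p = r + 1" "p - int (Suc d) = r - int d"
    by (simp_all add: q_def r_def)
  note prems = Suc.prems[unfolded qr]
  have mono: "?c n \<le> ?c q"
    by (rule cut_mono[OF m]) (simp add: q_def)
  \<comment> \<open>The block of \<open>x q\<close> fits to the right of \<open>j\<close>, since the
    two words have equal length and the first begins at or before that block.\<close>
  have jle: "j \<le> ?c (r + 1) - int (length (\<sigma> [x q]))"
    using prems(2) mono unfolding cut_add_one[OF m] by simp
  have "suffix (\<sigma> [x q]) (factor_co ?y (?c n) (?c (q + 1)))"
    by (rule suffix_block_factor_co[OF m mono])
  also have "\<dots> = factor_co ?y j (?c (r + 1))"
    by (rule prems(1))
  \<comment> \<open>The block of \<open>x r\<close> may still start to the left of \<open>j\<close>.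
    Extending the word to \<open>min j (?c r)\<close> makes both blocks suffixes of the same
    word.\<close>
  also have "suffix \<dots> (factor_co ?y (min j (?c r)) (?c (r + 1)))"
    using jle by (intro suffix_factor_co) auto
  finally have "suffix (\<sigma> [x q]) (factor_co ?y (min j (?c r)) (?c (r + 1)))" .
  moreover have "suffix (\<sigma> [x r]) (factor_co ?y (min j (?c r)) (?c (r + 1)))"
    by (rule suffix_block_factor_co[OF m]) simp
  ultimately have block: "\<sigma> [x q] = \<sigma> [x r]"
    using code by (intro suffix_code_eqI) auto
  \<comment> \<open>Equal blocks have equal length, so the block of \<open>x r\<close> does not
    reach beyond \<open>j\<close> after all.\<close>
  have jr: "j \<le> ?c r" "?c r - j = ?c q - ?c n"
    using jle prems(2) unfolding cut_add_one[OF m] block by simp_all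
  have "factor_co ?y (?c n) (?c q) @ \<sigma> [x q] = factor_co ?y j (?c r) @ \<sigma> [x r]"
    using prems(1) factor_co_append[OF mono cut_mono[OF m], of "q + 1" ?y]
      factor_co_append[OF jr(1) cut_mono[OF m], of "r + 1" ?y]
    by (simp add: factor_co_morphism_image_cut[OF m])
  then have "factor_co ?y (?c n) (?c q) = factor_co ?y j (?c r)"
    by (simp add: block)
  then show ?case
    using Suc.IH[of r] jr(2) by (simp add: qr q_def)
qed simp

lemma mosse_recognizable_if_one_sided:
  assumes "one_sided_mosse_recognizable \<sigma> x"
  shows "mosse_recognizable \<sigma> x"
proof -
  let ?y = "morphism_image \<sigma> x"
  obtain N where N: "N \<ge> 1"
    and rec: "\<And>i j. factor_co ?y i (i + N) = factor_co ?y j (j + N) \<Longrightarrow>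
      i \<in> cutting_points \<sigma> x \<longleftrightarrow> j \<in> cutting_points \<sigma> x"
    using assms unfolding one_sided_mosse_recognizable_def Let_def by blast
  have "i \<in> cutting_points \<sigma> x \<longleftrightarrow> j \<in> cutting_points \<sigma> x"
    if "factor_cc ?y (i - N) (i + N) = factor_cc ?y (j - N) (j + N)" for i j
    \<comment> \<open>The same \<open>N\<close> serves: the offsets from 0 to \<open>N - 1\<close>
      lie among those from \<open>- N\<close> to \<open>N\<close>.\<close>
    using that N by (intro rec) (simp add: factor_cc_window_eq_iff factor_co_eq_iff)
  then show ?thesis using N unfolding mosse_recognizable_def Let_def by blast
qed

lemma one_sided_if_mosse_recognizable:
  fixes \<sigma> :: "'a::finite list \<Rightarrow> 'b list"
  assumes m: "is_morphism \<sigma>" and code: "suffix_code (range (\<lambda>a. \<sigma> [a]))"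
    and "mosse_recognizable \<sigma> x"
  shows "one_sided_mosse_recognizable \<sigma> x"
proof -
  let ?y = "morphism_image \<sigma> x" and ?C = "cutting_points \<sigma> x" and ?c = "cut \<sigma> x"
  obtain N where N: "N \<ge> 1"
    and rec: "\<And>i j. factor_cc ?y (i - N) (i + N) = factor_cc ?y (j - N) (j + N) \<Longrightarrow>
      i \<in> ?C \<longleftrightarrow> j \<in> ?C"
    using assms(3) unfolding mosse_recognizable_def Let_def by blast
  have ne: "\<sigma> [a] \<noteq> []" for a
    using code unfolding suffix_code_def by (metis rangeI)
  define L where "L = Max (range (\<lambda>a. length (\<sigma> [a])))"
  have L: "length (\<sigma> [a]) \<le> L" for a
    by (simp add: L_def)
  \<comment> \<open>\<open>N * int L\<close> bounds the shift \<open>k\<close> below,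
    \<open>N\<close> is the right half of the two-sided window, and the 1 passes from its closed end
    to a half-open window.\<close>
  define M where "M = N * int L + N + 1"
  have imp: "j \<in> ?C" if i: "i \<in> ?C" and eq: "factor_co ?y i (i + M) = factor_co ?y j (j + M)" for i j
  proof -
    have agree: "?y (i + t) = ?y (j + t)" if "0 \<le> t" "t < M" for t
      using eq that by (simp add: factor_co_eq_iff)
    obtain n where n: "i = ?c n"
      using i by (auto simp: cutting_points_eq_range_cut)
    define k where "k = ?c (n + int (nat N)) - i"
    have k: "N \<le> k" "k \<le> N * int L"
      using cut_add_bounds[OF m ne L, of x n "nat N"] N by (simp_all add: k_def n)
    \<comment> \<open>As \<open>N \<le> k\<close>, the left half of the window centred at
      \<open>i + k\<close> does not go beyond \<open>i\<close>; so \<open>k + t\<close> lies between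
      0 and \<open>M - 1\<close>.\<close>
    have "?y (i + k + t) = ?y (j + k + t)" if "- N \<le> t" "t \<le> N" for t
      using agree[of "k + t"] that k by (simp add: M_def add.assoc)
    then have "factor_cc ?y (i + k - N) (i + k + N) = factor_cc ?y (j + k - N) (j + k + N)"
      by (simp add: factor_cc_window_eq_iff)
    moreover have "i + k \<in> ?C"
      by (simp add: k_def cutting_points_eq_range_cut)
    ultimately have "j + k \<in> ?C"
      using rec by blast
    then obtain p where p: "j + k = ?c p"
      by (auto simp: cutting_points_eq_range_cut)
    have "factor_co ?y i (i + k) = factor_co ?y j (j + k)"
      using agree k N by (simp add: factor_co_eq_iff M_def)
    then have "factor_co ?y (?c n) (?c (n + int (nat N))) = factor_co ?y j (?c p)"
      by (simp add: k_def flip: p n)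
    then have "j = ?c (p - int (nat N))"
      by (rule suffix_code_synchronize_left[OF m code]) (simp add: k_def n flip: p)
    then show ?thesis
      by (simp add: cutting_points_eq_range_cut)
  qed
  have "M \<ge> 1" using N by (simp add: M_def)
  \<comment> \<open>Agreement of windows is symmetric in \<open>i\<close> and \<open>j\<close>, so
    \<open>imp\<close> gives both directions.\<close>
  moreover have "i \<in> ?C \<longleftrightarrow> j \<in> ?C" if "factor_co ?y i (i + M) = factor_co ?y j (j + M)" for i j
    using imp that by metis
  ultimately show ?thesis
    unfolding one_sided_mosse_recognizable_def Let_def by blast
qed

theorem proposition4p3:
  fixes \<sigma> :: "'a::finite list \<Rightarrow> 'b::finite list" and x :: "int \<Rightarrow> 'a"
  assumes "is_morphism \<sigma>" and "two_sided_infinite_image \<sigma> x"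
  shows "(one_sided_mosse_recognizable \<sigma> x \<longrightarrow> mosse_recognizable \<sigma> x) \<and>
    (suffix_code (range (\<lambda>a. \<sigma> [a])) \<and> mosse_recognizable \<sigma> x \<longrightarrow>
      one_sided_mosse_recognizable \<sigma> x)"
  using mosse_recognizable_if_one_sided one_sided_if_mosse_recognizable[OF assms(1)] by blast

end
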